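(* Let $P$ be a poset. The following are equivalent: (1) $P$ is continuous. (2) $A^{\downarrow\ll} = \operatorname{int}_\sigma(A)$ for every upper subset $A$ of $P$. (3) There exists an approximating auxiliary relation $\prec$ on $P$ such that $A^{\downarrow\prec} = \operatorname{int}_\sigma(A)$ for every upper subset $A$ of $P$. (4) $A^{\uparrow\ll} = \operatorname{cl}_\sigma(A)$ for every lower subset $A$ of $P$. (5) There exists an approximating auxiliary relation $\prec$ on $P$ such that $A^{\uparrow\prec} = \operatorname{cl}_\sigma(A)$ for every lower subset $A$ of $P$.
   Context: For a poset $(P,\le)$ and $X\subseteq P$, $\mathord{\downarrow}X=\{x\in P\mid \exists y\in X,\ x\le y\}$ and $\mathord{\uparrow}X=\{x\in P\mid \exists y\in X,\ y\le x\}$; $X$ is a lower (upper) set if $X=\mathord{\downarrow}X$ ($X=\mathord{\uparrow}X$). A subset is directed if it is nonempty and every finite subset has an upper bound in it. The way-below relation: $x\ll y$ iff for every directed $D\subseteq P$ whose supremum exists with $\bigvee D\ge y$, there is $d\in D$ with $x\le d$. $P$ is continuous if for every $x$, the set $\{y\mid y\ll x\}$ is directed with supremum $x$. An auxiliary relation on $P$ is a binary relation $\prec$ such that: $x\prec y$ implies $x\le y$; $u\le x\prec y\le z$ implies $u\prec z$; if $P$ has a least element $\bot$ then $\bot\prec x$ for all $x$ (both $\le$ and $\ll$ are auxiliary). Write $s_\prec(x)=\{y\in P\mid y\prec x\}$. $\prec$ is approximating if for every $x$, $s_\prec(x)$ is directed and $\bigvee s_\prec(x)=x$. For $A\subseteq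 P$, the lower approximation is $A^{\downarrow\prec}=\{x\in P\mid x\in A \text{ and } s_\prec(x)\cap A\neq\emptyset\}$ and the upper approximation is $A^{\uparrow\prec}=\{x\in P\mid s_\prec(x)\subseteq \mathord{\downarrow}A\}$. A set $U$ is Scott open if it is an upper set and whenever $D$ is directed with $\bigvee D$ existing and in $U$, then $D\cap U\ne\emptyset$; $\operatorname{int}_\sigma$ and $\operatorname{cl}_\sigma$ denote interior and closure in the Scott topology. *)

theory Defs
  imports "HOL-Analysis.Abstract_Topology" "HOL-Library.Lub_Glb"
begin

text \<open>
  The poset is the type \<open>'a\<close> with its \<open>order\<close> class structure; \<open>isLub UNIV D s\<close> says that the
  supremum of \<open>D\<close> in it exists and equals \<open>s\<close>.
\<close>

definition down_closure :: "'a::order set \<Rightarrow> 'a set" where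
  "down_closure X = {x. \<exists>y\<in>X. x \<le> y}"

definition up_closure :: "'a::order set \<Rightarrow> 'a set" where
  "up_closure X = {x. \<exists>y\<in>X. y \<le> x}"

definition lower_set :: "'a::order set \<Rightarrow> bool" where
  "lower_set X \<longleftrightarrow> X = down_closure X"

definition upper_set :: "'a::order set \<Rightarrow> bool" where
  "upper_set X \<longleftrightarrow> X = up_closure X"

definition directed_set :: "'a::order set \<Rightarrow> bool" where
  "directed_set D \<longleftrightarrow> D \<noteq> {} \<and> (\<forall>F. finite F \<and> F \<subseteq> D \<longrightarrow> (\<exists>d\<in>D. \<forall>x\<in>F. x \<le> d))"

definition way_below :: "'a::order \<Rightarrow> 'a \<Rightarrow> bool"  (infix \<open>\<lless>\<close> 50) where
  "x \<lless> y \<longleftrightarrow> (\<forall>D s. directed_set D \<and> isLub UNIV D s \<and> y \<le> s \<longrightarrow> (\<exists>d\<in>D. x \<le> d))"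

definition continuous_poset :: "'a::order itself \<Rightarrow> bool" where
  "continuous_poset _ \<longleftrightarrow> (\<forall>x::'a. directed_set {y. y \<lless> x} \<and> isLub UNIV {y. y \<lless> x} x)"

definition auxiliary_relation :: "('a::order \<Rightarrow> 'a \<Rightarrow> bool) \<Rightarrow> bool" where
  "auxiliary_relation r \<longleftrightarrow>
     (\<forall>x y. r x y \<longrightarrow> x \<le> y) \<and>
     (\<forall>u x y z. u \<le> x \<and> r x y \<and> y \<le> z \<longrightarrow> r u z) \<and>
     (\<forall>b. (\<forall>y. b \<le> y) \<longrightarrow> (\<forall>x. r b x))"

definition below_set :: "('a \<Rightarrow> 'a \<Rightarrow> bool) \<Rightarrow> 'a \<Rightarrow> 'a set" where
  "below_set r x = {y. r y x}"

definition approximating :: "('a::order \<Rightarrow> 'a \<Rightarrow> bool) \<Rightarrow> bool" where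
  "approximating r \<longleftrightarrow> (\<forall>x. directed_set (below_set r x) \<and> isLub UNIV (below_set r x) x)"

definition lower_approx :: "('a::order \<Rightarrow> 'a \<Rightarrow> bool) \<Rightarrow> 'a set \<Rightarrow> 'a set" where
  "lower_approx r A = {x. x \<in> A \<and> below_set r x \<inter> A \<noteq> {}}"

definition upper_approx :: "('a::order \<Rightarrow> 'a \<Rightarrow> bool) \<Rightarrow> 'a set \<Rightarrow> 'a set" where
  "upper_approx r A = {x. below_set r x \<subseteq> down_closure A}"

definition scott_open :: "'a::order set \<Rightarrow> bool" where
  "scott_open U \<longleftrightarrow>
     upper_set U \<and> (\<forall>D s. directed_set D \<and> isLub UNIV D s \<and> s \<in> U \<longrightarrow> D \<inter> U \<noteq> {})"

definition scott_topology :: "'a::order topology" where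
  "scott_topology = topology scott_open"

lemma upper_set_iff: "upper_set X \<longleftrightarrow> (\<forall>x\<in>X. \<forall>y. x \<le> y \<longrightarrow> y \<in> X)"
  unfolding upper_set_def up_closure_def by blast

lemma directed_set_pair:
  assumes "directed_set D" "x \<in> D" "y \<in> D"
  obtains d where "d \<in> D" "x \<le> d" "y \<le> d"
proof -
  have "finite {x, y} \<and> {x, y} \<subseteq> D"
    using assms by simp
  then have "\<exists>d\<in>D. \<forall>z\<in>{x, y}. z \<le> d"
    using assms(1) unfolding directed_set_def by blast
  then show thesis
    using that by blast
qed

lemma istopology_scott_open: "istopology scott_open"
  unfolding istopology_def
proof (intro conjI allI impI)
  fix S T :: "'a set"
  assume S: "scott_open S" and T: "scott_open T"
  show "scott_open (S \<inter> T)"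
    unfolding scott_open_def
  proof (intro conjI allI impI)
    show "upper_set (S \<inter> T)"
      using S T unfolding scott_open_def upper_set_iff by blast
  next
    fix D s
    assume D: "directed_set D \<and> isLub UNIV D s \<and> s \<in> S \<inter> T"
    then obtain x y where "x \<in> D" "x \<in> S" "y \<in> D" "y \<in> T"
      using S T unfolding scott_open_def by blast
    moreover from this D obtain d where "d \<in> D" "x \<le> d" "y \<le> d"
      using directed_set_pair by blast
    ultimately have "d \<in> D \<inter> (S \<inter> T)"
      using S T unfolding scott_open_def upper_set_iff by blast
    then show "D \<inter> (S \<inter> T) \<noteq> {}"
      by blast
  qed
next
  fix \<K> :: "'a set set"
  assume K: "\<forall>K\<in>\<K>. scott_open K"
  show "scott_open (\<Union>\<K>)"
    unfolding scott_open_def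
  proof (intro conjI allI impI)
    show "upper_set (\<Union>\<K>)"
      using K unfolding scott_open_def upper_set_iff by blast
  next
    fix D s
    assume D: "directed_set D \<and> isLub UNIV D s \<and> s \<in> \<Union>\<K>"
    then obtain U where "U \<in> \<K>" "s \<in> U"
      by blast
    with D K have "D \<inter> U \<noteq> {}"
      unfolding scott_open_def by blast
    with \<open>U \<in> \<K>\<close> show "D \<inter> \<Union>\<K> \<noteq> {}"
      by blast
  qed
qed

lemma openin_scott_topology [simp]: "openin scott_topology U \<longleftrightarrow> scott_open U"
  by (simp add: scott_topology_def istopology_scott_open topology_inverse')

lemma topspace_scott_topology [simp]: "topspace scott_topology = UNIV"
proof -
  have "scott_open (UNIV :: 'a set)"
    unfolding scott_open_def upper_set_iff directed_set_def by simp
  then have "openin scott_topology (UNIV :: 'a set)"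
    by simp
  then show ?thesis
    using openin_subset by blast
qed

end

theory Submission imports Defs begin

text \<open>
  For lower \<open>A\<close> the upper approximation of \<open>A\<close> is the complement of the lower approximation of
  \<open>- A\<close>, so (4) and (5) are dual to (2) and (3). The interpolation property makes the lower
  approximation Scott open in a continuous poset, whence (1) implies (2). For (2) implies (1), apply
  (2) to complements of principal ideals, which yields the suprema, and to principal filters and
  their Scott interiors, which yields directedness. An auxiliary relation as in (3) must be way-below
  itself, since \<open>r x y\<close> puts \<open>y\<close> in the Scott interior of the principal filter of \<open>x\<close>.
\<close>

text \<open>Suprema become one equivalence: the upper bounds of \<open>D\<close> form the principal
  filter of \<open>s\<close>. The instance \<open>b = s\<close> recovers that \<open>s\<close>
  itself is an upper bound.\<close>

lemma isLub_UNIV_iff: "isLub UNIV D (s::'a::order) \<longleftrightarrow> (\<forall>b. s \<le> b \<longleftrightarrow> (\<forall>d\<in>D. d \<le> b))"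
  unfolding isLub_def leastP_def isUb_def setle_def setge_def
  by (simp add: Ball_def) (meson order_refl order_trans)

lemma directed_set_iff:
  "directed_set D \<longleftrightarrow> D \<noteq> {} \<and> (\<forall>x\<in>D. \<forall>y\<in>D. \<exists>d\<in>D. x \<le> d \<and> y \<le> d)"
proof
  assume "directed_set D"
  then show "D \<noteq> {} \<and> (\<forall>x\<in>D. \<forall>y\<in>D. \<exists>d\<in>D. x \<le> d \<and> y \<le> d)"
    by (metis directed_set_def directed_set_pair)
next
  assume D: "D \<noteq> {} \<and> (\<forall>x\<in>D. \<forall>y\<in>D. \<exists>d\<in>D. x \<le> d \<and> y \<le> d)"
  have "\<exists>d\<in>D. \<forall>x\<in>F. x \<le> d" if "finite F" "F \<subseteq> D" for F
    using that
  proof (induction F rule: finite_induct)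
    case empty
    then show ?case using D by blast
  next
    case (insert x F)
    then obtain d where "d \<in> D" "\<forall>y\<in>F. y \<le> d" by blast
    moreover from this insert.prems D obtain e where "e \<in> D" "x \<le> e" "d \<le> e" by blast
    ultimately show ?case by (metis insert_iff order_trans)
  qed
  with D show "directed_set D" unfolding directed_set_def by blast
qed

lemma way_below_imp_le: "x \<lless> y \<Longrightarrow> x \<le> y"
proof -
  assume "x \<lless> y"
  moreover have "directed_set {y}" by (simp add: directed_set_iff)
  moreover have "isLub UNIV {y} y" by (simp add: isLub_UNIV_iff)
  ultimately show ?thesis unfolding way_below_def by blast
qed

lemma way_below_mono: "u \<le> x \<Longrightarrow> x \<lless> y \<Longrightarrow> y \<le> z \<Longrightarrow> u \<lless> z"
  unfolding way_below_def by (meson order_trans)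

lemma auxiliary_way_below: "auxiliary_relation (\<lless>)"
proof -
  have "b \<lless> x" if "\<forall>y. b \<le> y" for b x :: 'a
    using that unfolding way_below_def directed_set_def by blast
  then show ?thesis
    unfolding auxiliary_relation_def using way_below_imp_le way_below_mono by blast
qed

lemma continuous_poset_iff_approximating:
  "continuous_poset TYPE('a::order) \<longleftrightarrow> approximating ((\<lless>) :: 'a \<Rightarrow> 'a \<Rightarrow> bool)"
  unfolding continuous_poset_def approximating_def below_set_def ..

text \<open>A directed set bounded by \<open>z\<close> has its supremum below \<open>z\<close>.
  These open sets separate \<open>x\<close> from any \<open>z\<close> with
  \<open>\<not> x \<le> z\<close>.\<close>

lemma scott_open_Compl_atMost: "scott_open (- {..z})"
proof -
  have "upper_set (- {..z})" unfolding upper_set_iff by (auto dest: order_trans)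
  moreover have "D \<inter> - {..z} \<noteq> {}" if "isLub UNIV D s" "s \<in> - {..z}" for D s
  proof -
    from that obtain d where "d \<in> D" "\<not> d \<le> z" unfolding isLub_UNIV_iff by auto
    then show ?thesis by auto
  qed
  ultimately show ?thesis unfolding scott_open_def by blast
qed

lemma scott_open_imp_upper_set: "scott_open U \<Longrightarrow> upper_set U"
  by (simp add: scott_open_def)

lemma upper_set_atLeast: "upper_set {x..}"
  by (auto simp: upper_set_iff)

lemma lower_set_iff_upper_set_Compl: "lower_set A \<longleftrightarrow> upper_set (- A)"
  unfolding lower_set_def down_closure_def upper_set_iff by blast

text \<open>The elements two way-below steps under \<open>y\<close> form a directed set with
  supremum \<open>y\<close>, so \<open>x \<lless> y\<close> puts \<open>x\<close> below one of
  them.\<close>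

lemma way_below_interpolate:
  assumes cont: "continuous_poset TYPE('a::order)" and "x \<lless> (y::'a)"
  obtains z where "x \<lless> z" "z \<lless> y"
proof -
  have dir: "directed_set {w. w \<lless> z}" and lub: "isLub UNIV {w. w \<lless> z} z" for z :: 'a
    using cont unfolding continuous_poset_def by blast+
  let ?E = "{w. \<exists>z. w \<lless> z \<and> z \<lless> y}"
  have "directed_set ?E"
    unfolding directed_set_iff
  proof (intro conjI ballI)
    show "?E \<noteq> {}"
    proof -
      obtain z where "z \<lless> y" using dir[of y] unfolding directed_set_iff by blast
      moreover obtain w where "w \<lless> z" using dir[of z] unfolding directed_set_iff by blast
      ultimately show ?thesis by blast
    qed
  next
    fix a b assume "a \<in> ?E" "b \<in> ?E"
    then obtain a' b' where ab: "a \<lless> a'" "a' \<lless> y" "b \<lless> b'" "b' \<lless> y" by blast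
    then obtain c where c: "c \<lless> y" "a' \<le> c" "b' \<le> c"
      using dir[of y] unfolding directed_set_iff by (metis mem_Collect_eq)
    then have "a \<lless> c" "b \<lless> c" using ab way_below_mono by blast+
    then obtain d where "d \<lless> c" "a \<le> d" "b \<le> d"
      using dir[of c] unfolding directed_set_iff by (metis mem_Collect_eq)
    with c show "\<exists>d\<in>?E. a \<le> d \<and> b \<le> d" by blast
  qed
  \<comment> \<open>A bound of \<open>?E\<close> bounds \<open>{w. w \<lless> z}\<close> for each
    \<open>z \<lless> y\<close>, hence each such \<open>z\<close>, hence \<open>y\<close>:
    \<open>lub\<close> is used at both levels.\<close>
  moreover have "isLub UNIV ?E y"
    using lub unfolding isLub_UNIV_iff by blast
  ultimately have "\<exists>w\<in>?E. x \<le> w"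
    using \<open>x \<lless> y\<close> unfolding way_below_def by (meson order_refl)
  then obtain w where "w \<in> ?E" "x \<le> w" by blast
  then show thesis using that way_below_mono by blast
qed

lemma lower_approx_way_below_eq_interior:
  assumes cont: "continuous_poset TYPE('a::order)" and A: "upper_set (A::'a set)"
  shows "lower_approx (\<lless>) A = scott_topology interior_of A"
proof (rule interior_of_unique[symmetric])
  show "lower_approx (\<lless>) A \<subseteq> A" unfolding lower_approx_def by blast
  \<comment> \<open>Since \<open>A\<close> is upper, a \<open>y \<in> A\<close> with
    \<open>y \<lless> x\<close> already forces \<open>x \<in> A\<close>.\<close>
  have iff: "x \<in> lower_approx (\<lless>) A \<longleftrightarrow> (\<exists>y\<in>A. y \<lless> x)" for x
    using A way_below_imp_le unfolding lower_approx_def below_set_def upper_set_iff by blast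
  have "scott_open (lower_approx (\<lless>) A)"
    unfolding scott_open_def upper_set_iff
  proof (intro conjI ballI allI impI)
    fix x y assume "x \<in> lower_approx (\<lless>) A" "x \<le> y"
    then show "y \<in> lower_approx (\<lless>) A"
      unfolding iff using way_below_mono by blast
  next
    fix D s assume D: "directed_set D \<and> isLub UNIV D s \<and> s \<in> lower_approx (\<lless>) A"
    then obtain a where a: "a \<in> A" "a \<lless> s" unfolding iff by blast
    \<comment> \<open>An element \<open>d\<close> of \<open>D\<close> above \<open>a\<close> alone
      would not do; the interpolant gives \<open>a \<lless> z \<le> d\<close>, so \<open>d\<close>
      lies in the lower approximation.\<close>
    from cont this(2) obtain z where z: "a \<lless> z" "z \<lless> s" by (rule way_below_interpolate)
    then obtain d where "d \<in> D" "z \<le> d" using D unfolding way_below_def by blast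
    with a z show "D \<inter> lower_approx (\<lless>) A \<noteq> {}"
      using iff way_below_mono by blast
  qed
  then show "openin scott_topology (lower_approx (\<lless>) A)" by simp
  \<comment> \<open>Each \<open>x \<in> U\<close> is the directed supremum of the elements way below
    it, so one of these lies in \<open>U\<close> and thus in \<open>A\<close>.\<close>
  fix U assume "U \<subseteq> A" "openin scott_topology U"
  then show "U \<subseteq> lower_approx (\<lless>) A"
    using cont iff unfolding continuous_poset_def by (fastforce simp: scott_open_def)
qed

lemma continuous_poset_if_lower_approx:
  assumes eq: "\<And>A::'a::order set. upper_set A \<Longrightarrow> lower_approx (\<lless>) A = scott_topology interior_of A"
  shows "continuous_poset TYPE('a)"
  unfolding continuous_poset_def
proof (intro allI conjI)
  \<comment> \<open>A Scott open \<open>U\<close> is its own interior, hence its own lower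
    approximation.\<close>
  have meets: "\<exists>y\<in>U. y \<lless> x" if "scott_open U" "x \<in> U" for U and x :: 'a
    using that eq[OF scott_open_imp_upper_set, OF that(1)] interior_of_openin[of scott_topology U]
    by (auto simp: lower_approx_def below_set_def)
  fix x :: 'a
  \<comment> \<open>Otherwise \<open>x\<close> lies in the open set \<open>- {..z}\<close>, and
    \<open>meets\<close> gives some \<open>y \<lless> x\<close> not below \<open>z\<close>.\<close>
  have "x \<le> z" if "\<forall>y\<in>{y. y \<lless> x}. y \<le> z" for z
    using meets[OF scott_open_Compl_atMost] that by auto
  then show "isLub UNIV {y. y \<lless> x} x"
    unfolding isLub_UNIV_iff using way_below_imp_le order_trans by blast
  \<comment> \<open>The element \<open>a\<close> itself witnesses that \<open>x\<close> is in the
    lower approximation of \<open>{a..}\<close>.\<close>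
  have int: "x \<in> scott_topology interior_of {a..}" if "a \<lless> x" for a
    using that way_below_imp_le[OF that]
    unfolding eq[OF upper_set_atLeast, symmetric] lower_approx_def below_set_def by auto
  show "directed_set {y. y \<lless> x}"
    unfolding directed_set_iff
  proof (intro conjI ballI)
    have "scott_open (UNIV :: 'a set)"
      using openin_topspace[of scott_topology] by simp
    then show "{y. y \<lless> x} \<noteq> {}" using meets by blast
  next
    fix a b assume "a \<in> {y. y \<lless> x}" "b \<in> {y. y \<lless> x}"
    then have "x \<in> scott_topology interior_of {a..} \<inter> scott_topology interior_of {b..}"
      using int by blast
    \<comment> \<open>By \<open>meets\<close>, this open neighbourhood of \<open>x\<close> contains
      some \<open>d \<lless> x\<close>, and all its members lie above both \<open>a\<close> and
      \<open>b\<close>.\<close>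
    moreover have "openin scott_topology (scott_topology interior_of {a..} \<inter> scott_topology interior_of {b..})"
      by (intro openin_Int openin_interior_of)
    ultimately obtain d where "d \<lless> x"
        "d \<in> scott_topology interior_of {a..} \<inter> scott_topology interior_of {b..}"
      using meets by (metis openin_scott_topology)
    then show "\<exists>d\<in>{y. y \<lless> x}. a \<le> d \<and> b \<le> d"
      using interior_of_subset[of scott_topology "{a..}"] interior_of_subset[of scott_topology "{b..}"]
      by auto
  qed
qed

text \<open>A directed set whose supremum is above \<open>y\<close> has that supremum in the
  interior, so it meets the interior and has a member above \<open>x\<close>.\<close>

lemma way_below_if_interior_of_atLeast:
  assumes "y \<in> scott_topology interior_of {x..}"
  shows "x \<lless> y"
proof -
  obtain U where U: "scott_open U" "y \<in> U" "U \<subseteq> {x..}"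
    using assms unfolding interior_of_def by auto
  show ?thesis
    unfolding way_below_def
  proof (intro allI impI)
    fix D s assume D: "directed_set D \<and> isLub UNIV D s \<and> y \<le> s"
    then have "s \<in> U" using U unfolding scott_open_def upper_set_iff by blast
    with D U have "D \<inter> U \<noteq> {}" unfolding scott_open_def by blast
    with U show "\<exists>d\<in>D. x \<le> d" by auto
  qed
qed

lemma approximating_lower_approx_imp_way_below:
  assumes aux: "auxiliary_relation (r::'a::order \<Rightarrow> 'a \<Rightarrow> bool)" and approx: "approximating r"
    and eq: "\<And>A. upper_set A \<Longrightarrow> lower_approx r A = scott_topology interior_of A"
  shows "r = (\<lless>)"
proof (intro ext iffI)
  have le: "r x y \<Longrightarrow> x \<le> y" for x y :: 'a
    using aux unfolding auxiliary_relation_def by blast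
  fix x y :: 'a assume "r x y"
  then have "y \<in> lower_approx r {x..}"
    using le[OF \<open>r x y\<close>] unfolding lower_approx_def below_set_def by auto
  then show "x \<lless> y"
    using eq[OF upper_set_atLeast] way_below_if_interior_of_atLeast by blast
next
  \<comment> \<open>This direction comes from approximation: \<open>below_set r y\<close> is a
    directed set with supremum \<open>y\<close>, to which \<open>x \<lless> y\<close>
    applies.\<close>
  fix x y :: 'a assume "x \<lless> y"
  moreover have "directed_set (below_set r y)" "isLub UNIV (below_set r y) y"
    using approx unfolding approximating_def by blast+
  ultimately have "\<exists>d\<in>below_set r y. x \<le> d"
    unfolding way_below_def by (meson order_refl)
  then obtain d where "r d y" "x \<le> d" unfolding below_set_def by blast
  then show "r x y" using aux unfolding auxiliary_relation_def by (meson order_refl)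
qed

text \<open>As \<open>- A\<close> is lower, both sides say that no \<open>r\<close>-predecessor of
  \<open>x\<close> is in \<open>A\<close>: such a predecessor would be below \<open>x\<close> and
  force \<open>x \<in> A\<close>.\<close>

lemma upper_approx_Compl:
  assumes "auxiliary_relation r" "upper_set A"
  shows "upper_approx r (- A) = - lower_approx r A"
proof -
  have "down_closure (- A) = - A"
    using assms(2) lower_set_iff_upper_set_Compl[of "- A"] unfolding lower_set_def by simp
  moreover have "r y x \<Longrightarrow> y \<le> x" for x y
    using assms(1) unfolding auxiliary_relation_def by blast
  ultimately show ?thesis
    using assms(2) unfolding upper_approx_def lower_approx_def below_set_def upper_set_iff by blast
qed

text \<open>Complementation exchanges upper with lower sets and interior with closure. The relation
  stays fixed, so one witness serves both existential conditions.\<close>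

lemma upper_approx_closure_iff:
  assumes "auxiliary_relation (r::'a::order \<Rightarrow> 'a \<Rightarrow> bool)"
  shows "(\<forall>A. lower_set A \<longrightarrow> upper_approx r A = scott_topology closure_of A) \<longleftrightarrow>
         (\<forall>A. upper_set A \<longrightarrow> lower_approx r A = scott_topology interior_of A)"
proof -
  have "upper_approx r (- A) = scott_topology closure_of (- A) \<longleftrightarrow>
        lower_approx r A = scott_topology interior_of A" if "upper_set A" for A
    using upper_approx_Compl[OF assms that] closure_of_complement[of scott_topology A]
    by (simp add: Compl_eq_Diff_UNIV[symmetric])
  then show ?thesis
    by (metis lower_set_iff_upper_set_Compl double_complement)
qed

theorem theorem3p28:
  shows
    "(continuous_poset TYPE('a::order) \<longleftrightarrow>
        (\<forall>A::'a set. upper_set A \<longrightarrow> lower_approx (\<lless>) A = scott_topology interior_of A)) \<and>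
     (continuous_poset TYPE('a) \<longleftrightarrow>
        (\<exists>r::'a \<Rightarrow> 'a \<Rightarrow> bool. auxiliary_relation r \<and> approximating r \<and>
          (\<forall>A. upper_set A \<longrightarrow> lower_approx r A = scott_topology interior_of A))) \<and>
     (continuous_poset TYPE('a) \<longleftrightarrow>
        (\<forall>A::'a set. lower_set A \<longrightarrow> upper_approx (\<lless>) A = scott_topology closure_of A)) \<and>
     (continuous_poset TYPE('a) \<longleftrightarrow>
        (\<exists>r::'a \<Rightarrow> 'a \<Rightarrow> bool. auxiliary_relation r \<and> approximating r \<and>
          (\<forall>A. lower_set A \<longrightarrow> upper_approx r A = scott_topology closure_of A)))"
proof -
  let ?C = "continuous_poset TYPE('a)"
  let ?L = "\<lambda>r::'a \<Rightarrow> 'a \<Rightarrow> bool. \<forall>A. upper_set A \<longrightarrow> lower_approx r A = scott_topology interior_of A"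
  let ?U = "\<lambda>r::'a \<Rightarrow> 'a \<Rightarrow> bool. \<forall>A. lower_set A \<longrightarrow> upper_approx r A = scott_topology closure_of A"
  have L: "?C \<longleftrightarrow> ?L (\<lless>)"
    using lower_approx_way_below_eq_interior continuous_poset_if_lower_approx by blast
  have exL: "?C \<longleftrightarrow> (\<exists>r. auxiliary_relation r \<and> approximating r \<and> ?L r)"
  proof
    assume ?C
    then have "auxiliary_relation ((\<lless>) :: 'a \<Rightarrow> _) \<and> approximating ((\<lless>) :: 'a \<Rightarrow> _) \<and> ?L (\<lless>)"
      using L auxiliary_way_below continuous_poset_iff_approximating by blast
    then show "\<exists>r. auxiliary_relation r \<and> approximating r \<and> ?L r" by (intro exI[of _ "(\<lless>)"])
  next
    assume "\<exists>r. auxiliary_relation r \<and> approximating r \<and> ?L r"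
    then obtain r where r: "auxiliary_relation r" "approximating r" "?L r" by blast
    then have "r = (\<lless>)" by (intro approximating_lower_approx_imp_way_below) blast+
    with r(2) show ?C by (simp add: continuous_poset_iff_approximating)
  qed
  have U: "?C \<longleftrightarrow> ?U (\<lless>)"
    using L by (simp only: upper_approx_closure_iff[OF auxiliary_way_below])
  have exU: "?C \<longleftrightarrow> (\<exists>r. auxiliary_relation r \<and> approximating r \<and> ?U r)"
    unfolding exL using upper_approx_closure_iff by (intro ex_cong1) blast
  show ?thesis
    by (intro conjI L exL U exU)
qed

end
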